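(* Let $T>0$, $I=[0,T]$, and let $\alpha,\beta\in\mathcal{C}(I)$ satisfy $0<m\le\alpha(t),\beta(t)\le M\le 1$ for every $t\in I$, where $m,M$ are constants. Put $$\Gamma_{\mathrm{low}}:=\min_{z\in[m,M]}\Gamma(z)>0,\qquad \Gamma_{\mathrm{up}}:=\max_{z\in[m,M]}\Gamma(z),\qquad C_W:=\frac{(M+1)\Gamma_{\mathrm{up}}}{(m+1)\Gamma_{\mathrm{low}}}\ \ (\ge 1).$$ Then for any $x\in\mathcal{C}^1(I)$: (i) for every $t\in(0,T]$, $$\min\bigl\{1,t^{\beta(t)-\alpha(t)}\bigr\}\cdot\bigl|\mathscr{V}_{\alpha,\beta}[x](t)\bigr|\le C_W\|x\|_{\mathcal{C}^1};$$ (ii) at $t=0$, $\bigl|\mathscr{V}_{\alpha,\beta}[x](0)\bigr|\le C_W\|x\|_{\mathcal{C}^1}$.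
   Context: $\mathcal{C}(I)$ is the space of continuous real-valued functions on $I=[0,T]$ with $\|x\|_\infty=\sup_{t\in I}|x(t)|$; $\mathcal{C}^1(I)$ is the space of continuously differentiable functions on $I$ (one-sided derivatives at the endpoints) with norm $\|x\|_{\mathcal{C}^1}=\|x\|_\infty+\|\dot{x}\|_\infty$. A time-varying memory exponent is a continuous function $\varrho:I\to\mathbb{R}$ with $\varrho(t)\in(0,1]$ for all $t\in I$. Its memory kernel is $K_\varrho(t,\tau)=\frac{(t-\tau)^{\varrho(t)-1}}{\Gamma(\varrho(t))}$ for $0\le\tau<t\le T$, and $K_\varrho(t,\tau)=0$ for $\tau\ge t$, where $\Gamma$ is the Gamma function. For memory exponents $\alpha,\beta$ and $x\in\mathcal{C}^1(I)$, the memory-weighted velocity operator is the function $\mathscr{V}_{\alpha,\beta}[x]:I\to\mathbb{R}$ given by $$\mathscr{V}_{\alpha,\beta}[x](t)=\frac{\int_0^t K_\alpha(t,\tau)\,[x(t)-x(\tau)]\,d\tau}{\int_0^t K_\beta(t,\tau)\,(t-\tau)\,d\tau}\quad (t\in(0,T]),\qquad \mathscr{V}_{\alpha,\beta}[x](0)=\dot{x}(0).$$ *)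

theory Defs
  imports "HOL-Analysis.Analysis"
begin

text \<open>
  Elements of the function spaces over the interval from 0 to T are total functions on the
  reals of which only the values on that interval matter. Derivatives are taken within the
  closed interval, so they are one-sided at the endpoints.
\<close>

abbreviation deriv_on :: "real \<Rightarrow> (real \<Rightarrow> real) \<Rightarrow> real \<Rightarrow> real" where
  "deriv_on T x t \<equiv> vector_derivative x (at t within {0..T})"

definition C1_on :: "real \<Rightarrow> (real \<Rightarrow> real) \<Rightarrow> bool" where
  "C1_on T x \<longleftrightarrow> x differentiable_on {0..T} \<and> continuous_on {0..T} (deriv_on T x)"

definition sup_norm :: "real \<Rightarrow> (real \<Rightarrow> real) \<Rightarrow> real" where
  "sup_norm T x = (SUP t\<in>{0..T}. \<bar>x t\<bar>)"

definition C1_norm :: "real \<Rightarrow> (real \<Rightarrow> real) \<Rightarrow> real" where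
  "C1_norm T x = sup_norm T x + sup_norm T (deriv_on T x)"

definition memory_kernel :: "(real \<Rightarrow> real) \<Rightarrow> real \<Rightarrow> real \<Rightarrow> real" where
  "memory_kernel \<rho> t \<tau> = (if \<tau> < t then (t - \<tau>) powr (\<rho> t - 1) / Gamma (\<rho> t) else 0)"

definition memory_velocity ::
    "real \<Rightarrow> (real \<Rightarrow> real) \<Rightarrow> (real \<Rightarrow> real) \<Rightarrow> (real \<Rightarrow> real) \<Rightarrow> real \<Rightarrow> real" where
  "memory_velocity T \<alpha> \<beta> x t =
     (if t = 0 then deriv_on T x 0
      else integral {0..t} (\<lambda>\<tau>. memory_kernel \<alpha> t \<tau> * (x t - x \<tau>)) /
           integral {0..t} (\<lambda>\<tau>. memory_kernel \<beta> t \<tau> * (t - \<tau>)))"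

text \<open>
  Minimum and maximum of the Gamma function on the interval from m to M. They exist for
  positive m with m at most M, by compactness (\<^const>\<open>Min\<close> and \<^const>\<open>Max\<close> are only
  meaningful for finite sets).
\<close>

definition Gamma_low :: "real \<Rightarrow> real \<Rightarrow> real" where
  "Gamma_low m M = (LEAST g. g \<in> Gamma ` {m..M})"

definition Gamma_up :: "real \<Rightarrow> real \<Rightarrow> real" where
  "Gamma_up m M = (GREATEST g. g \<in> Gamma ` {m..M})"

definition C_W :: "real \<Rightarrow> real \<Rightarrow> real" where
  "C_W m M = ((M + 1) * Gamma_up m M) / ((m + 1) * Gamma_low m M)"

end

theory Submission
  imports Defs
begin

text \<open>
  By the mean value theorem \<open>\<bar>x t - x \<tau>\<bar> \<le> sup_norm T x' * (t - \<tau>)\<close>, so the numerator of the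
  velocity is at most \<open>sup_norm T x'\<close> times the integral in the denominator with \<open>\<alpha>\<close> in place
  of \<open>\<beta>\<close>. That integral equals \<open>t powr (\<rho> + 1) / ((\<rho> + 1) * Gamma \<rho>)\<close>, so the quotient is
  at most \<open>t powr (\<alpha> - \<beta>)\<close> times a factor bounded by \<open>C_W\<close>.
\<close>

lemma has_integral_powr_reflect:
  fixes a t :: real
  assumes "0 < a" "0 \<le> t"
  shows "((\<lambda>\<tau>. (t - \<tau>) powr a) has_integral t powr (a + 1) / (a + 1)) {0..t}"
proof -
  let ?F = "\<lambda>\<tau>. - ((t - \<tau>) powr (a + 1) / (a + 1))"
  have "((\<lambda>\<tau>. (t - \<tau>) powr a) has_integral ?F t - ?F 0) {0..t}"
  \<comment> \<open>At \<tau> = t the base of the power vanishes, and the derivative rule for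
    \<open>powr\<close> applies only to a positive base. The interior form asks for mere continuity
    at the endpoints.\<close>
  proof (rule fundamental_theorem_of_calculus_interior)
    show "continuous_on {0..t} ?F"
      using assms
      by (intro continuous_on_minus continuous_on_divide continuous_on_powr' continuous_intros) auto
    fix \<tau> assume "\<tau> \<in> {0<..<t}"
    then have "(?F has_real_derivative (t - \<tau>) powr a) (at \<tau>)"
      using assms by (auto intro!: derivative_eq_intros simp: add_eq_0_iff)
    then show "(?F has_vector_derivative (t - \<tau>) powr a) (at \<tau>)"
      by (simp add: has_real_derivative_iff_has_vector_derivative)
  qed (use assms in auto)
  then show ?thesis
    using assms by simp
qed

text \<open>The factor \<open>t - \<tau>\<close> raises the exponent \<open>\<rho> t - 1\<close> to
  the positive \<open>\<rho> t\<close>, which removes the singularity of the kernel at \<tau> =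
  t.\<close>

lemma has_integral_memory_kernel:
  assumes "0 < \<rho> t" "0 \<le> t"
  shows "((\<lambda>\<tau>. memory_kernel \<rho> t \<tau> * (t - \<tau>)) has_integral
           t powr (\<rho> t + 1) / ((\<rho> t + 1) * Gamma (\<rho> t))) {0..t}"
proof -
  have "((\<lambda>\<tau>. (t - \<tau>) powr \<rho> t / Gamma (\<rho> t)) has_integral
           t powr (\<rho> t + 1) / (\<rho> t + 1) / Gamma (\<rho> t)) {0..t}"
    by (intro has_integral_divide has_integral_powr_reflect assms)
  moreover have "(t - \<tau>) powr \<rho> t / Gamma (\<rho> t) = memory_kernel \<rho> t \<tau> * (t - \<tau>)"
    if "\<tau> \<in> {0..t}" for \<tau>
    \<comment> \<open>At \<tau> = t both sides are 0: \<open>0 powr \<rho> t\<close> is 0, and so is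
      the kernel.\<close>
    using that assms by (auto simp: memory_kernel_def powr_diff)
  ultimately show ?thesis
    unfolding divide_divide_eq_left by (rule has_integral_eq[rotated])
qed

lemma abs_integral_memory_kernel_le:
  assumes "0 < \<rho> t" "0 \<le> t" "0 \<le> B"
    and bound: "\<And>\<tau>. \<tau> \<in> {0..t} \<Longrightarrow> \<bar>x t - x \<tau>\<bar> \<le> B * (t - \<tau>)"
  shows "\<bar>integral {0..t} (\<lambda>\<tau>. memory_kernel \<rho> t \<tau> * (x t - x \<tau>))\<bar>
           \<le> B * (t powr (\<rho> t + 1) / ((\<rho> t + 1) * Gamma (\<rho> t)))"
    (is "\<bar>integral _ ?f\<bar> \<le> ?R")
proof (cases "?f integrable_on {0..t}")
  case True
  note J = has_integral_mult_right[OF has_integral_memory_kernel[of \<rho> t, OF assms(1,2)], of B]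
  have "norm (integral {0..t} ?f)
          \<le> integral {0..t} (\<lambda>\<tau>. B * (memory_kernel \<rho> t \<tau> * (t - \<tau>)))"
  proof (rule integral_norm_bound_integral[OF True])
    show "(\<lambda>\<tau>. B * (memory_kernel \<rho> t \<tau> * (t - \<tau>))) integrable_on {0..t}"
      using J by blast
    fix \<tau> assume \<tau>: "\<tau> \<in> {0..t}"
    have k: "0 \<le> memory_kernel \<rho> t \<tau>"
      using Gamma_real_pos[OF assms(1)] by (simp add: memory_kernel_def)
    then show "norm (?f \<tau>) \<le> B * (memory_kernel \<rho> t \<tau> * (t - \<tau>))"
      using mult_left_mono[OF bound[OF \<tau>] k] by (simp add: abs_mult mult_ac)
  qed
  then show ?thesis
    using integral_unique[OF J] by simp
next
  \<comment> \<open>\<open>integral\<close> has the default value 0 here, and the right-hand side is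
    nonnegative.\<close>
  case False
  then show ?thesis
    using assms(1,3) Gamma_real_pos[OF assms(1)] by (simp add: not_integrable_integral)
qed

text \<open>Compactness of the interval bounds the set of values, so that its supremum really is an
  upper bound.\<close>

lemma abs_le_sup_norm:
  assumes "continuous_on {0..T} f" "t \<in> {0..T}"
  shows "\<bar>f t\<bar> \<le> sup_norm T f"
proof -
  have "compact ((\<lambda>t. \<bar>f t\<bar>) ` {0..T})"
    using assms(1) by (intro compact_continuous_image continuous_intros) auto
  then have "bdd_above ((\<lambda>t. \<bar>f t\<bar>) ` {0..T})"
    by (intro bounded_imp_bdd_above compact_imp_bounded)
  then show ?thesis
    unfolding sup_norm_def using assms(2) by (intro cSUP_upper)
qed

lemma C1_on_lipschitz:
  assumes "C1_on T x" "s \<in> {0..T}" "t \<in> {0..T}"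
  shows "\<bar>x t - x s\<bar> \<le> sup_norm T (deriv_on T x) * \<bar>t - s\<bar>"
proof -
  have D: "(x has_field_derivative deriv_on T x u) (at u within {0..T})" if "u \<in> {0..T}" for u
    using assms(1) that
    by (simp add: C1_on_def differentiable_on_def has_real_derivative_iff_has_vector_derivative
        vector_derivative_works[symmetric])
  have "norm (x t - x s) \<le> sup_norm T (deriv_on T x) * norm (t - s)"
    using assms abs_le_sup_norm[of T "deriv_on T x"]
    by (intro field_differentiable_bound[where S = "{0..T}" and f' = "deriv_on T x"] D)
       (auto simp: C1_on_def)
  then show ?thesis by simp
qed

text \<open>Since m > 0, the interval avoids the poles of \<open>Gamma\<close>, so
  \<open>Gamma\<close> is continuous there and attains its extrema. This is what gives
  \<open>LEAST\<close> and \<open>GREATEST\<close> their intended values.\<close>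

lemma
  assumes "0 < m" "m \<le> M"
  shows Gamma_low_pos: "0 < Gamma_low m M"
    and Gamma_low_le: "\<And>z. z \<in> {m..M} \<Longrightarrow> Gamma_low m M \<le> Gamma z"
    and Gamma_le_up: "\<And>z. z \<in> {m..M} \<Longrightarrow> Gamma z \<le> Gamma_up m M"
proof -
  have "continuous_on {m..M} (Gamma :: real \<Rightarrow> real)"
    using assms by (intro continuous_on_Gamma) (auto dest: nonpos_Ints_nonpos)
  moreover have "compact {m..M}" "{m..M} \<noteq> {}"
    using assms by auto
  ultimately obtain a b where a: "a \<in> {m..M}" "\<forall>z\<in>{m..M}. Gamma a \<le> Gamma z"
    and b: "b \<in> {m..M}" "\<forall>z\<in>{m..M}. Gamma z \<le> Gamma b"
    using continuous_attains_inf[of "{m..M}" Gamma] continuous_attains_sup[of "{m..M}" Gamma]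
    by metis
  have low: "Gamma_low m M = Gamma a"
    unfolding Gamma_low_def using a by (intro Least_equality) auto
  have up: "Gamma_up m M = Gamma b"
    unfolding Gamma_up_def using b by (intro Greatest_equality) auto
  show "0 < Gamma_low m M"
    using a assms by (simp add: low Gamma_real_pos)
  show "Gamma_low m M \<le> Gamma z" "Gamma z \<le> Gamma_up m M" if "z \<in> {m..M}" for z
    using that a b by (auto simp: low up)
qed

text \<open>This quotient collects the constants left over when the two closed-form integrals are
  divided. Numerator and denominator are estimated separately, all factors being
  nonnegative.\<close>

lemma Gamma_quotient_le_C_W:
  assumes "0 < m" "a \<in> {m..M}" "b \<in> {m..M}"
  shows "((b + 1) * Gamma b) / ((a + 1) * Gamma a) \<le> C_W m M"
proof -
  have mM: "m \<le> M" using assms by auto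
  note G = Gamma_low_pos[OF assms(1) mM] Gamma_low_le[OF assms(1) mM] Gamma_le_up[OF assms(1) mM]
  have "0 < Gamma b"
    using assms by (intro Gamma_real_pos) auto
  with G(3)[OF assms(3)] have b: "0 \<le> Gamma b" "0 \<le> Gamma_up m M"
    by auto
  show ?thesis
    unfolding C_W_def
  proof (rule frac_le)
    show "0 \<le> (M + 1) * Gamma_up m M"
      using b assms by auto
    show "(b + 1) * Gamma b \<le> (M + 1) * Gamma_up m M"
      using b G(3)[OF assms(3)] assms by (intro mult_mono) auto
    show "0 < (m + 1) * Gamma_low m M"
      using G(1) assms by simp
    show "(m + 1) * Gamma_low m M \<le> (a + 1) * Gamma a"
      using G(1) G(2)[OF assms(2)] assms by (intro mult_mono) auto
  qed
qed

text \<open>Taking a = b = m makes the preceding quotient equal to 1.\<close>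

lemma C_W_ge_1:
  assumes "0 < m" "m \<le> M"
  shows "1 \<le> C_W m M"
  using Gamma_quotient_le_C_W[of m m M m] Gamma_real_pos[OF assms(1)] assms by simp

lemma abs_memory_velocity_le:
  assumes "C1_on T x" "0 < t" "t \<le> T" "0 < m" "\<alpha> t \<in> {m..M}" "\<beta> t \<in> {m..M}"
  shows "\<bar>memory_velocity T \<alpha> \<beta> x t\<bar>
           \<le> C_W m M * sup_norm T (deriv_on T x) * t powr (\<alpha> t - \<beta> t)"
proof -
  let ?B = "sup_norm T (deriv_on T x)"
  let ?I = "\<lambda>\<rho>. t powr (\<rho> + 1) / ((\<rho> + 1) * Gamma \<rho>)"
  have pos: "0 < \<alpha> t" "0 < \<beta> t" using assms by auto
  note G = Gamma_real_pos[OF pos(1)] Gamma_real_pos[OF pos(2)]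
  have B: "0 \<le> ?B"
    using abs_le_sup_norm[of T "deriv_on T x" t] assms by (auto simp: C1_on_def)
  have "\<bar>integral {0..t} (\<lambda>\<tau>. memory_kernel \<alpha> t \<tau> * (x t - x \<tau>))\<bar> \<le> ?B * ?I (\<alpha> t)"
    using C1_on_lipschitz[OF assms(1), of _ t] assms pos B
    by (intro abs_integral_memory_kernel_le) fastforce+
  moreover have "integral {0..t} (\<lambda>\<tau>. memory_kernel \<beta> t \<tau> * (t - \<tau>)) = ?I (\<beta> t)"
    using has_integral_memory_kernel[of \<beta> t] pos assms by (simp add: integral_unique)
  moreover have I: "0 < ?I (\<beta> t)"
    using pos G assms by simp
  ultimately have "\<bar>memory_velocity T \<alpha> \<beta> x t\<bar> \<le> ?B * ?I (\<alpha> t) / \<bar>?I (\<beta> t)\<bar>"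
    unfolding memory_velocity_def using assms(2)
    by (simp only: abs_divide less_imp_neq[symmetric] if_False) (rule divide_right_mono, auto)
  also have "\<bar>?I (\<beta> t)\<bar> = ?I (\<beta> t)"
    using I by (rule abs_of_pos)
  \<comment> \<open>Dividing by \<open>?I (\<beta> t)\<close> moves its constants into the
    numerator, hence the swapped roles of \<alpha> and \<beta>.\<close>
  also have "?B * ?I (\<alpha> t) / ?I (\<beta> t) = ((\<beta> t + 1) * Gamma (\<beta> t)) / ((\<alpha> t + 1) * Gamma (\<alpha> t)) *
      (?B * (t powr (\<alpha> t + 1) / t powr (\<beta> t + 1)))"
    by (simp add: mult_ac)
  also have "t powr (\<alpha> t + 1) / t powr (\<beta> t + 1) = t powr (\<alpha> t - \<beta> t)"
    by (simp flip: powr_diff)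
  also have "((\<beta> t + 1) * Gamma (\<beta> t)) / ((\<alpha> t + 1) * Gamma (\<alpha> t)) * (?B * t powr (\<alpha> t - \<beta> t))
      \<le> C_W m M * (?B * t powr (\<alpha> t - \<beta> t))"
    using Gamma_quotient_le_C_W[OF assms(4-6)] B by (intro mult_right_mono) auto
  finally show ?thesis by (simp add: mult.assoc)
qed

theorem theorem2p3:
  fixes T m M :: real and \<alpha> \<beta> :: "real \<Rightarrow> real"
  assumes "T > 0"
    and "continuous_on {0..T} \<alpha>" and "continuous_on {0..T} \<beta>"
    and "0 < m" and "M \<le> 1"
    and "\<And>t. t \<in> {0..T} \<Longrightarrow> m \<le> \<alpha> t \<and> \<alpha> t \<le> M"
    and "\<And>t. t \<in> {0..T} \<Longrightarrow> m \<le> \<beta> t \<and> \<beta> t \<le> M"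
  shows "Gamma_low m M > 0 \<and> C_W m M \<ge> 1 \<and>
    (\<forall>x. C1_on T x \<longrightarrow>
      (\<forall>t\<in>{0<..T}. min 1 (t powr (\<beta> t - \<alpha> t)) * \<bar>memory_velocity T \<alpha> \<beta> x t\<bar>
                     \<le> C_W m M * C1_norm T x) \<and>
      \<bar>memory_velocity T \<alpha> \<beta> x 0\<bar> \<le> C_W m M * C1_norm T x)"
proof -
  have mM: "m \<le> M"
    using assms(1) assms(6)[of 0] by simp
  note C = C_W_ge_1[OF assms(4) mM]
  have "(\<forall>t\<in>{0<..T}. min 1 (t powr (\<beta> t - \<alpha> t)) * \<bar>memory_velocity T \<alpha> \<beta> x t\<bar>
                       \<le> C_W m M * C1_norm T x) \<and>
        \<bar>memory_velocity T \<alpha> \<beta> x 0\<bar> \<le> C_W m M * C1_norm T x" if x: "C1_on T x" for x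
  proof -
    let ?B = "sup_norm T (deriv_on T x)"
    \<comment> \<open>The bound on \<open>x 0\<close> shows that \<open>sup_norm T x\<close> is
      nonnegative, so that adding it to \<open>?B\<close> can only enlarge the norm.\<close>
    have "\<bar>x 0\<bar> \<le> sup_norm T x" and d0: "\<bar>deriv_on T x 0\<bar> \<le> ?B"
      using x assms(1)
      by (auto intro!: abs_le_sup_norm differentiable_imp_continuous_on simp: C1_on_def)
    then have B: "?B \<le> C1_norm T x" "0 \<le> C1_norm T x"
      by (auto simp: C1_norm_def)
    have CB: "C_W m M * ?B \<le> C_W m M * C1_norm T x"
      using B C by (intro mult_left_mono) auto
    have "min 1 (t powr (\<beta> t - \<alpha> t)) * \<bar>memory_velocity T \<alpha> \<beta> x t\<bar> \<le> C_W m M * C1_norm T x"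
      if t: "t \<in> {0<..T}" for t
    proof -
      \<comment> \<open>The weight is replaced by the second argument of \<open>min\<close>, whose
        product with \<open>t powr (\<alpha> t - \<beta> t)\<close> is 1 because t > 0.\<close>
      have "min 1 (t powr (\<beta> t - \<alpha> t)) * \<bar>memory_velocity T \<alpha> \<beta> x t\<bar>
              \<le> t powr (\<beta> t - \<alpha> t) * (C_W m M * ?B * t powr (\<alpha> t - \<beta> t))"
        using t assms x by (intro mult_mono abs_memory_velocity_le) auto
      also have "\<dots> = C_W m M * ?B * (t powr (\<beta> t - \<alpha> t) * t powr (\<alpha> t - \<beta> t))"
        by (simp only: mult_ac)
      also have "\<dots> = C_W m M * ?B"
        using t by (simp flip: powr_add)
      finally show ?thesis using CB by simp
    qed
    \<comment> \<open>For t = 0: the velocity there is the derivative, already bounded by the norm,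
      and \<open>1 \<le> C_W m M\<close> lets the constant be inserted.\<close>
    moreover have "C1_norm T x \<le> C_W m M * C1_norm T x"
      using mult_right_mono[OF C B(2)] by simp
    ultimately show ?thesis
      using d0 B(1) by (auto simp: memory_velocity_def)
  qed
  with C Gamma_low_pos[OF assms(4) mM] show ?thesis by blast
qed

end
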